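(* Let $\alpha>0$ be a constant and let $\delta(\varepsilon)>0$ be any function with $\delta(\varepsilon)\to0$ as $\varepsilon\to0+$ and $\delta(\varepsilon)\ge\alpha\varepsilon$. Then there is a constant $\beta>0$ independent of $c$ and $\varepsilon$ such that for each $c\in(c_-,c_+)$, the uniform limit $v^\ast=\lim_{\varepsilon\to0+}v^\varepsilon$ satisfies $$|v^\varepsilon(x)-v^\ast(x)|\le\beta\big(\varepsilon|\log\delta(\varepsilon)|^2+\delta(\varepsilon)\big)\quad\text{for all }x\in\mathbb{T}$$ as $\varepsilon\to0+$ (i.e. for all sufficiently small $\varepsilon>0$).
   Context: Here $n=1$, $\mathbb{T}=\mathbb{R}/\mathbb{Z}$, and $H(x,p)=\frac12p^2-F(x)$ with $F\in C^2(\mathbb{T})$, $F\ge0$, where $F$ has finitely many zeros $0\le x_1<\dots<x_I<1$ and $F_{xx}(x_i)>0$ for each $i$. Set $c_\pm:=\pm\int_{\mathbb{T}}\sqrt{2F(x)}\,dx$. For $c\in(c_-,c_+)$ the effective Hamiltonian is $h(c)=0$, i.e. $0$ is the unique constant for which $\frac12(c+v_x)^2-F(x)=h(c)$ has a viscosity solution on $\mathbb{T}$. For $\varepsilon>0$, $v^\varepsilon$ is the unique viscosity solution of $\varepsilon v^\varepsilon+\frac12(c+v^\varepsilon_x)^2-F(x)=0$ on $\mathbb{T}$. It is known that $v^\varepsilon$ converges uniformly on $\mathbb{T}$ as $\varepsilon\to0+$ to a viscosity solution $v^\ast$ of $\frac12(c+v_x)^2-F(x)=0$. *)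

theory Defs
  imports "HOL-Analysis.Analysis"
begin

text \<open>Functions on the torus R/Z are represented as 1-periodic functions on the reals.\<close>

definition periodic1 :: "(real \<Rightarrow> real) \<Rightarrow> bool" where
  "periodic1 u \<longleftrightarrow> (\<forall>x. u (x + 1) = u x)"

definition C1_test :: "(real \<Rightarrow> real) \<Rightarrow> (real \<Rightarrow> real) \<Rightarrow> bool" where
  "C1_test \<phi> \<phi>' \<longleftrightarrow> (\<forall>y. (\<phi> has_real_derivative \<phi>' y) (at y)) \<and> continuous_on UNIV \<phi>'"

definition viscosity_subsolution :: "(real \<Rightarrow> real \<Rightarrow> real \<Rightarrow> real) \<Rightarrow> (real \<Rightarrow> real) \<Rightarrow> bool" where
  "viscosity_subsolution G u \<longleftrightarrow>
     (\<forall>x \<phi> \<phi>'. C1_test \<phi> \<phi>' \<and> (\<forall>\<^sub>F y in at x. u y - \<phi> y \<le> u x - \<phi> x)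
        \<longrightarrow> G x (u x) (\<phi>' x) \<le> 0)"

definition viscosity_supersolution :: "(real \<Rightarrow> real \<Rightarrow> real \<Rightarrow> real) \<Rightarrow> (real \<Rightarrow> real) \<Rightarrow> bool" where
  "viscosity_supersolution G u \<longleftrightarrow>
     (\<forall>x \<phi> \<phi>'. C1_test \<phi> \<phi>' \<and> (\<forall>\<^sub>F y in at x. u y - \<phi> y \<ge> u x - \<phi> x)
        \<longrightarrow> G x (u x) (\<phi>' x) \<ge> 0)"

definition viscosity_solution_T :: "(real \<Rightarrow> real \<Rightarrow> real \<Rightarrow> real) \<Rightarrow> (real \<Rightarrow> real) \<Rightarrow> bool" where
  "viscosity_solution_T G u \<longleftrightarrow> continuous_on UNIV u \<and> periodic1 u \<and>
     viscosity_subsolution G u \<and> viscosity_supersolution G u"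

definition c_plus :: "(real \<Rightarrow> real) \<Rightarrow> real" where
  "c_plus F = integral {0..1} (\<lambda>x. sqrt (2 * F x))"

definition c_minus :: "(real \<Rightarrow> real) \<Rightarrow> real" where
  "c_minus F = - integral {0..1} (\<lambda>x. sqrt (2 * F x))"

end

theory Submission
  imports Defs
begin

text \<open>
  Write \<open>u = v\<^sup>\<epsilon>\<close> and \<open>s = sqrt (2 (F - \<epsilon> u))\<close>. The subsolution property says that \<open>c + u'\<close> lies
  between \<open>-s\<close> and \<open>s\<close>; the supersolution property forbids convex kinks, so from every point \<open>x\<close>
  one can follow \<open>u' = s - c\<close> to the left or \<open>u' = -s - c\<close> to the right until \<open>s\<close> vanishes at
  some \<open>y\<close>, which happens within one period because \<open>\<bar>c\<bar> < c\<^sub>+\<close>. There \<open>u y = F y / \<epsilon> \<ge> 0\<close>, and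
  since \<open>u \<le> 0\<close> at the zeros of \<open>F\<close>, the Lipschitz bound and the quadratic growth of \<open>F\<close> at its
  zeros put \<open>y\<close> within \<open>O(\<epsilon>)\<close> of a zero and give \<open>s \<ge> sqrt (2 F) - O(\<epsilon>)\<close>. Conversely, \<open>u\<close> is
  bounded below, so \<open>s \<le> sqrt (2 F + O(\<epsilon>))\<close>, whose integral exceeds that of \<open>sqrt (2 F)\<close> by
  \<open>O(\<epsilon> \<bar>ln \<epsilon>\<bar>)\<close>. Comparing \<open>v\<^sup>\<epsilon>\<close> and \<open>v\<^sup>\<eta>\<close> along the same segment from \<open>y\<close> to \<open>x\<close> and letting
  \<open>\<eta> \<rightarrow> 0\<close> yields the rate \<open>\<epsilon> \<bar>ln \<epsilon>\<bar>\<close>, which is dominated by \<open>\<epsilon> \<bar>ln d\<bar>\<^sup>2 + d\<close> for every \<open>d > 0\<close>.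
\<close>

section \<open>Viscosity solutions on the line\<close>

lemma antiderivative_on_reals:
  fixes g :: "real \<Rightarrow> real"
  assumes "continuous_on UNIV g"
  obtains G where "\<And>x. (G has_real_derivative g x) (at x)"
proof -
  have "\<exists>G. \<forall>x. -\<infinity> < ereal x \<longrightarrow> ereal x < \<infinity> \<longrightarrow> (G has_vector_derivative g x) (at x)"
    by (rule einterval_antiderivative) (use assms in \<open>auto simp: continuous_on_eq_continuous_at\<close>)
  then show thesis
    using that by (auto simp: has_real_derivative_iff_has_vector_derivative)
qed

text \<open>If \<open>u - G\<close> rose by \<Delta> from \<open>x\<close> to \<open>z\<close>,
  subtracting a suitable increasing \<open>k\<close> would give it an interior maximum over
  \<open>{x..z+1}\<close>. There \<open>G + k\<close> touches \<open>u\<close> from above with slope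
  larger than \<open>g\<close>, against \<open>touch\<close>.\<close>

lemma viscosity_increment_le:
  fixes u g G :: "real \<Rightarrow> real"
  assumes u: "continuous_on UNIV u" and g: "continuous_on UNIV g"
    and G: "\<And>x. (G has_real_derivative g x) (at x)"
    and touch: "\<And>x \<phi> \<phi>'. C1_test \<phi> \<phi>' \<Longrightarrow> \<forall>\<^sub>F y in at x. u y - \<phi> y \<le> u x - \<phi> x \<Longrightarrow> \<phi>' x \<le> g x"
    and "x \<le> z"
  shows "u z - u x \<le> G z - G x"
proof (rule ccontr)
  define h where "h y = u y - G y" for y
  define \<Delta> where "\<Delta> = h z - h x"
  assume "\<not> u z - u x \<le> G z - G x"
  then have \<Delta>: "\<Delta> > 0" by (simp add: \<Delta>_def h_def)
  then have "x < z" using \<open>x \<le> z\<close> by (cases "x = z") (auto simp: \<Delta>_def)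
  \<comment> \<open>Since exp N \<ge> 1 + N, this \<open>N\<close> makes \<open>k (z + 1)\<close> at
    least \<Delta> plus any rise of \<open>h\<close> beyond \<open>z\<close>, while
    \<open>k z\<close> is only \<Delta>/2. So neither end of the interval can carry the
    maximum.\<close>
  define N where "N = 1 + 2 * \<bar>h (z + 1) - h z\<bar> / \<Delta>"
  define k where "k y = \<Delta> / 2 * exp (N * (y - z))" for y
  have N: "N > 0" using \<Delta> by (simp add: N_def add_pos_nonneg)
  have Gc: "continuous_on UNIV G"
    using G by (meson DERIV_isCont continuous_at_imp_continuous_on)
  have "continuous_on {x..z+1} (\<lambda>y. h y - k y)"
    unfolding h_def k_def
    by (intro continuous_intros continuous_on_subset[OF u] continuous_on_subset[OF Gc]) auto
  then obtain y0 where y0: "y0 \<in> {x..z+1}" "\<And>y. y \<in> {x..z+1} \<Longrightarrow> h y - k y \<le> h y0 - k y0"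
    using continuous_attains_sup[of "{x..z+1}" "\<lambda>y. h y - k y"] \<open>x < z\<close> by auto
  have kz: "k z = \<Delta> / 2" "k x > 0" using \<Delta> by (auto simp: k_def)
  have "h x - k x < h z - k z" using kz \<Delta> by (simp add: \<Delta>_def)
  then have "y0 \<noteq> x" using y0(2)[of z] \<open>x < z\<close> by auto
  have "k (z + 1) \<ge> \<Delta> / 2 * (1 + N)"
    unfolding k_def using \<Delta> exp_ge_add_one_self[of N] by simp
  also have "\<Delta> / 2 * (1 + N) = \<Delta> + \<bar>h (z + 1) - h z\<bar>"
    using \<Delta> by (simp add: N_def field_simps)
  finally have "h (z + 1) - k (z + 1) < h z - k z" using kz \<Delta> by linarith
  then have "y0 \<noteq> z + 1" using y0(2)[of z] \<open>x < z\<close> by auto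
  with \<open>y0 \<noteq> x\<close> y0(1) have "y0 \<in> {x<..<z+1}" by auto
  then have "\<forall>\<^sub>F y in at y0. y \<in> {x<..<z+1}"
    by (intro eventually_at_in_open') auto
  then have ev: "\<forall>\<^sub>F y in at y0. u y - (G y + k y) \<le> u y0 - (G y0 + k y0)"
    by eventually_elim (use y0(2) in \<open>auto simp: h_def algebra_simps\<close>)
  have "C1_test (\<lambda>y. G y + k y) (\<lambda>y. g y + \<Delta> / 2 * (exp (N * (y - z)) * N))"
    unfolding C1_test_def k_def
    by (auto intro!: derivative_eq_intros G continuous_intros g)
  from touch[OF this ev] have "\<Delta> / 2 * (exp (N * (y0 - z)) * N) \<le> 0" by simp
  with \<Delta> N show False by (simp add: mult_le_0_iff)
qed

text \<open>Reflection \<open>y \<mapsto> -y\<close> reverses slopes but keeps touching from above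
  as touching from above. Both one-sided bounds therefore come from the subsolution test
  alone.\<close>

lemma viscosity_increment_ge:
  fixes u g G :: "real \<Rightarrow> real"
  assumes u: "continuous_on UNIV u" and g: "continuous_on UNIV g"
    and G: "\<And>x. (G has_real_derivative g x) (at x)"
    and touch: "\<And>x \<phi> \<phi>'. C1_test \<phi> \<phi>' \<Longrightarrow> \<forall>\<^sub>F y in at x. u y - \<phi> y \<le> u x - \<phi> x \<Longrightarrow> \<phi>' x \<ge> g x"
    and "x \<le> z"
  shows "u z - u x \<ge> G z - G x"
proof -
  have "u (- (- x)) - u (- (- z)) \<le> G (- (- x)) - G (- (- z))"
  proof (rule viscosity_increment_le[where u = "\<lambda>y. u (- y)" and G = "\<lambda>y. G (- y)"])
    show "continuous_on UNIV (\<lambda>y. u (- y))" "continuous_on UNIV (\<lambda>y. - g (- y))"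
      by (intro continuous_intros continuous_on_compose2[OF u] continuous_on_compose2[OF g]; simp)+
    show "((\<lambda>y. G (- y)) has_real_derivative - g (- y)) (at y)" for y
      using G DERIV_mirror by blast
    show "\<phi>' y \<le> - g (- y)"
      if \<phi>: "C1_test \<phi> \<phi>'" and ev: "\<forall>\<^sub>F t in at y. u (- t) - \<phi> t \<le> u (- y) - \<phi> y" for y \<phi> \<phi>'
    proof -
      have c: "continuous_on UNIV \<phi>'" and d: "\<And>y. (\<phi> has_real_derivative \<phi>' y) (at y)"
        using \<phi> by (auto simp: C1_test_def)
      have "C1_test (\<lambda>t. \<phi> (- t)) (\<lambda>t. - \<phi>' (- t))"
        unfolding C1_test_def using d DERIV_mirror
        by (auto intro!: continuous_intros continuous_on_compose2[OF c])
      moreover from ev have "\<forall>\<^sub>F t in at (- y). u t - \<phi> (- t) \<le> u (- y) - \<phi> (- (- y))"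
        by (simp add: filtermap_at_minus[symmetric] eventually_filtermap)
      ultimately show ?thesis using touch[of "\<lambda>t. \<phi> (- t)" "\<lambda>t. - \<phi>' (- t)" "- y"] by simp
    qed
    show "- z \<le> - x" using \<open>x \<le> z\<close> by simp
  qed
  then show ?thesis by simp
qed

section \<open>Periodic functions and comparison of increments\<close>

lemma periodic1_add_int:
  assumes "periodic1 f"
  shows "f (x + of_int k) = f x"
proof (induction k rule: int_induct[where k = 0])
  case (step1 i)
  then show ?case
    using assms unfolding periodic1_def by (metis add.assoc of_int_1 of_int_add)
next
  case (step2 i)
  then show ?case
    using assms unfolding periodic1_def by (metis add.assoc diff_add_cancel of_int_1 of_int_add)
qed simp

lemma periodic1_frac:
  assumes "periodic1 f"
  shows "f (frac x) = f x"
  using periodic1_add_int[OF assms, of "frac x" "\<lfloor>x\<rfloor>"] by (simp add: frac_def)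

lemma periodic1_attains_inf:
  fixes f :: "real \<Rightarrow> real"
  assumes "periodic1 f" "continuous_on UNIV f"
  obtains x where "\<And>y. f x \<le> f y"
proof -
  obtain x where x: "x \<in> {0..1}" "\<And>y. y \<in> {0..1} \<Longrightarrow> f x \<le> f y"
    using continuous_attains_inf[of "{0..1::real}" f] continuous_on_subset[OF assms(2)] by auto
  have "f x \<le> f y" for y
    using x(2)[of "frac y"] periodic1_frac[OF assms(1), of y] frac_ge_0[of y] frac_lt_1[of y] by auto
  then show thesis by (rule that)
qed

lemma mono_increment:
  fixes A B a b :: "real \<Rightarrow> real"
  assumes "\<And>x. (A has_real_derivative a x) (at x)" "\<And>x. (B has_real_derivative b x) (at x)"
    and "\<And>t. x \<le> t \<Longrightarrow> t \<le> z \<Longrightarrow> a t \<le> b t" and "x \<le> z"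
  shows "A z - A x \<le> B z - B x"
proof -
  have "B x - A x \<le> B z - A z"
    using \<open>x \<le> z\<close>
  proof (rule DERIV_nonneg_imp_nondecreasing)
    fix t assume "x \<le> t" "t \<le> z"
    then show "\<exists>y. ((\<lambda>t. B t - A t) has_real_derivative y) (at t) \<and> 0 \<le> y"
      using assms by (intro exI[of _ "b t - a t"]) (auto intro!: derivative_intros)
  qed
  then show ?thesis by simp
qed

section \<open>The discounted equation\<close>

text \<open>The Isabelle \<open>sqrt\<close> is odd, so \<open>s\<close> is continuous before the
  sign of \<open>F - \<epsilon> u\<close> is known. An antiderivative \<open>S\<close> stands in for
  integrals of \<open>s\<close> over segments.\<close>

locale discounted_solution =
  fixes F :: "real \<Rightarrow> real" and \<epsilon> c :: real and u s S :: "real \<Rightarrow> real"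
  assumes F_cont: "continuous_on UNIV F"
    and F_nonneg: "\<And>x. F x \<ge> 0"
    and \<epsilon>_pos: "\<epsilon> > 0"
    and sol: "viscosity_solution_T (\<lambda>x r p. \<epsilon> * r + (c + p)\<^sup>2 / 2 - F x) u"
    and s_def: "\<And>x. s x = sqrt (2 * (F x - \<epsilon> * u x))"
    and S_deriv: "\<And>x. (S has_real_derivative s x) (at x)"
begin

lemma u_cont: "continuous_on UNIV u" and u_per: "periodic1 u"
  using sol by (auto simp: viscosity_solution_T_def)

lemma s_cont: "continuous_on UNIV s"
  unfolding s_def by (intro continuous_intros F_cont u_cont)

lemma touch_above:
  assumes "C1_test \<phi> \<phi>'" "\<forall>\<^sub>F y in at x. u y - \<phi> y \<le> u x - \<phi> x"
  shows "\<bar>c + \<phi>' x\<bar> \<le> s x"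
proof -
  have "\<epsilon> * u x + (c + \<phi>' x)\<^sup>2 / 2 - F x \<le> 0"
    using sol assms unfolding viscosity_solution_T_def viscosity_subsolution_def by blast
  then have "(c + \<phi>' x)\<^sup>2 \<le> 2 * (F x - \<epsilon> * u x)" by simp
  then show ?thesis unfolding s_def by (rule real_le_rsqrt[of "\<bar>c + \<phi>' x\<bar>", simplified])
qed

lemma touch_below:
  assumes "C1_test \<phi> \<phi>'" "\<forall>\<^sub>F y in at x. u y - \<phi> y \<ge> u x - \<phi> x"
  shows "(c + \<phi>' x)\<^sup>2 \<ge> 2 * (F x - \<epsilon> * u x)"
  using sol assms unfolding viscosity_solution_T_def viscosity_supersolution_def
  by (fastforce simp: field_simps)

lemma increment_le:
  assumes "x \<le> z"
  shows "u z - u x \<le> S z - S x - c * (z - x)"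
proof -
  have "u z - u x \<le> (S z - c * z) - (S x - c * x)"
  proof (rule viscosity_increment_le[OF u_cont _ _ _ assms])
    show "continuous_on UNIV (\<lambda>y. s y - c)" by (intro continuous_intros s_cont)
    show "((\<lambda>z. S z - c * z) has_real_derivative s y - c) (at y)" for y
      by (auto intro!: derivative_eq_intros S_deriv)
    show "\<phi>' y \<le> s y - c"
      if "C1_test \<phi> \<phi>'" "\<forall>\<^sub>F t in at y. u t - \<phi> t \<le> u y - \<phi> y" for y \<phi> \<phi>'
      using touch_above[OF that] by linarith
  qed
  then show ?thesis by (simp add: algebra_simps)
qed

lemma increment_ge:
  assumes "x \<le> z"
  shows "u z - u x \<ge> - (S z - S x) - c * (z - x)"
proof -
  have "u z - u x \<ge> (- S z - c * z) - (- S x - c * x)"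
  proof (rule viscosity_increment_ge[OF u_cont _ _ _ assms])
    show "continuous_on UNIV (\<lambda>y. - s y - c)" by (intro continuous_intros s_cont)
    show "((\<lambda>z. - S z - c * z) has_real_derivative - s y - c) (at y)" for y
      by (auto intro!: derivative_eq_intros S_deriv)
    show "\<phi>' y \<ge> - s y - c"
      if "C1_test \<phi> \<phi>'" "\<forall>\<^sub>F t in at y. u t - \<phi> t \<le> u y - \<phi> y" for y \<phi> \<phi>'
      using touch_above[OF that] by linarith
  qed
  then show ?thesis by (simp add: algebra_simps)
qed

text \<open>Where \<open>s\<close> is negative, \<open>S\<close> decreases just to the right, and
  the upper bound on the increment of \<open>u\<close> falls below the lower one. This yields
  \<open>\<epsilon> u \<le> F\<close> even at points that no test function touches.\<close>

lemma s_nonneg: "s x \<ge> 0"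
proof (rule ccontr)
  assume "\<not> s x \<ge> 0"
  then obtain d where d: "d > 0" "\<And>h. 0 < h \<Longrightarrow> h < d \<Longrightarrow> S (x + h) < S x"
    using DERIV_neg_dec_right[OF S_deriv[of x]] by auto
  then have "S (x + d / 2) < S x" by simp
  with increment_le[of x "x + d/2"] increment_ge[of x "x + d/2"] d(1) show False by linarith
qed

lemma F_ge: "\<epsilon> * u x \<le> F x"
  using s_nonneg[of x] by (simp add: s_def)

lemma s_sq: "(s x)\<^sup>2 = 2 * (F x - \<epsilon> * u x)"
  using F_ge[of x] by (simp add: s_def)

lemma u_nonpos: "F x = 0 \<Longrightarrow> u x \<le> 0"
  using F_ge[of x] \<epsilon>_pos by (simp add: mult_le_0_iff)

text \<open>At a global minimum of \<open>u\<close> the zero function touches from below, so the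
  supersolution test applies with slope 0.\<close>

lemma \<epsilon>_u_ge: "\<epsilon> * u x \<ge> - c\<^sup>2 / 2"
proof -
  obtain x0 where x0: "\<And>y. u x0 \<le> u y"
    using periodic1_attains_inf[OF u_per u_cont] by blast
  have "C1_test (\<lambda>_. 0) (\<lambda>_. 0)" by (auto simp: C1_test_def)
  from touch_below[OF this, of x0] x0 have "c\<^sup>2 \<ge> 2 * (F x0 - \<epsilon> * u x0)" by simp
  with F_nonneg[of x0] have "\<epsilon> * u x0 \<ge> - c\<^sup>2 / 2" by simp
  moreover have "\<epsilon> * u x \<ge> \<epsilon> * u x0" using x0 \<epsilon>_pos by simp
  ultimately show ?thesis by linarith
qed

text \<open>The lower bound on \<open>\<epsilon> u\<close> bounds \<open>s\<close>, and slopes of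
  \<open>u\<close> lie between \<open>-s - c\<close> and \<open>s - c\<close>. The constant involves
  neither \<epsilon> nor the particular \<open>c\<close>, as the uniform \<beta> requires.\<close>

lemma lipschitz:
  assumes b: "\<And>x. F x \<le> b" and "\<bar>c\<bar> \<le> K"
  shows "\<bar>u z - u x\<bar> \<le> (sqrt (2 * b + K\<^sup>2) + K) * \<bar>z - x\<bar>"
proof -
  define m where "m = sqrt (2 * b + K\<^sup>2)"
  have "c\<^sup>2 \<le> K\<^sup>2" using assms(2) by (simp add: abs_le_square_iff[symmetric])
  then have sb: "s x \<le> m" for x
    unfolding s_def m_def using \<epsilon>_u_ge[of x] b[of x] by (intro real_sqrt_le_mono) (simp add: right_diff_distrib)
  have *: "\<bar>u z - u x\<bar> \<le> (m + K) * (z - x)" if "x \<le> z" for x z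
  proof -
    have "S z - S x \<le> m * z - m * x"
      by (rule mono_increment[OF S_deriv, where b = "\<lambda>_. m"])
         (auto intro!: derivative_eq_intros sb that)
    moreover have "\<bar>c * (z - x)\<bar> \<le> K * (z - x)"
      using assms(2) that by (simp add: abs_mult mult_right_mono)
    ultimately show ?thesis
      using increment_le[OF that] increment_ge[OF that] by (simp add: algebra_simps abs_le_iff)
  qed
  show ?thesis
    using *[of x z] *[of z x] unfolding m_def[symmetric] by (cases "x \<le> z") auto
qed

text \<open>
  If \<open>u'\<close> were below \<open>s - c\<close> somewhere left of a place where it is above \<open>-s - c\<close>, then \<open>u\<close> could be
  touched from below by a function whose slope \<open>\<rho> s - c\<close> turns from \<open>\<rho> = \<theta>\<close> to \<open>\<rho> = -\<theta>\<close>, \<open>\<theta> < 1\<close>.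
\<close>

lemma no_convex_kink:
  assumes "p < q" "q < r" "r < t"
    and pos: "\<And>y. p < y \<Longrightarrow> y < t \<Longrightarrow> s y > 0"
    and left: "u q - u p \<noteq> S q - S p - c * (q - p)"
    and right: "u t - u r \<noteq> - (S t - S r) - c * (t - r)"
  shows False
proof -
  define a where "a = S q - S p"
  define a' where "a' = u q - u p + c * (q - p)"
  define b where "b = S t - S r"
  define b' where "b' = - (u t - u r + c * (t - r))"
  have "a' < a" "b' < b"
    using increment_le[of p q] increment_ge[of r t] assms by (auto simp: a_def a'_def b_def b'_def)
  \<comment> \<open>The two deficits are strict, so they survive shrinking the slopes by a factor
    \<theta> < 1 close to 1.\<close>
  have "\<forall>\<^sub>F \<theta> in at_left 1. a' < \<theta> * a"
    by (rule order_tendstoD(1)[where y = "1 * a"], intro tendsto_intros) (use \<open>a' < a\<close> in simp)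
  moreover have "\<forall>\<^sub>F \<theta> in at_left 1. b' < \<theta> * b"
    by (rule order_tendstoD(1)[where y = "1 * b"], intro tendsto_intros) (use \<open>b' < b\<close> in simp)
  moreover have "\<forall>\<^sub>F \<theta> in at_left (1::real). \<theta> \<in> {0<..<1}"
    by (rule eventually_at_leftI[of 0]) auto
  ultimately have "\<forall>\<^sub>F \<theta> in at_left 1. a' < \<theta> * a \<and> b' < \<theta> * b \<and> \<theta> \<in> {0<..<1}"
    by eventually_elim auto
  then obtain \<theta> where \<theta>: "a' < \<theta> * a" "b' < \<theta> * b" "0 < \<theta>" "\<theta> < 1"
    using eventually_happens'[OF trivial_limit_at_left_real] by fastforce
  \<comment> \<open>The linear passage from \<theta> to -\<theta> over \<open>{q..r}\<close> keeps
    the slope continuous, as a C1 test function needs.\<close>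
  define \<rho> where "\<rho> y = \<theta> * max (-1) (min 1 (1 - 2 * (y - q) / (r - q)))" for y
  have \<rho>_cont: "continuous_on UNIV \<rho>"
    unfolding \<rho>_def by (intro continuous_intros) (use assms in auto)
  have \<rho>_left: "\<rho> y = \<theta>" if "y \<le> q" for y
    using that assms by (simp add: \<rho>_def min_def max_def field_simps)
  have \<rho>_right: "\<rho> y = - \<theta>" if "r \<le> y" for y
    using that assms by (auto simp: \<rho>_def min_def max_def field_simps)
  have \<rho>_abs: "\<bar>\<rho> y\<bar> \<le> \<theta>" for y
    using \<theta> by (simp add: \<rho>_def abs_mult)
  have g_cont: "continuous_on UNIV (\<lambda>y. \<rho> y * s y)"
    by (intro continuous_intros \<rho>_cont s_cont)
  obtain \<Phi> where \<Phi>: "\<And>y. (\<Phi> has_real_derivative \<rho> y * s y) (at y)"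
    using antiderivative_on_reals[OF g_cont] by blast
  have "\<theta> * S q - \<theta> * S p \<le> \<Phi> q - \<Phi> p"
    by (rule mono_increment[OF _ \<Phi>, where a = "\<lambda>y. \<theta> * s y"])
       (use assms in \<open>auto intro!: derivative_eq_intros S_deriv simp: \<rho>_left\<close>)
  then have \<Phi>_left: "\<theta> * a \<le> \<Phi> q - \<Phi> p" by (simp add: a_def algebra_simps)
  have "\<Phi> t - \<Phi> r \<le> - \<theta> * S t - - \<theta> * S r"
    by (rule mono_increment[OF \<Phi>, where b = "\<lambda>y. - \<theta> * s y"])
       (use assms in \<open>auto intro!: derivative_eq_intros S_deriv simp: \<rho>_right\<close>)
  then have \<Phi>_right: "\<Phi> t - \<Phi> r \<le> - \<theta> * b" by (simp add: b_def algebra_simps)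
  define w where "w y = u y - (\<Phi> y - c * y)" for y
  have \<Phi>_cont: "continuous_on UNIV \<Phi>"
    using \<Phi> by (meson DERIV_isCont continuous_at_imp_continuous_on)
  have "continuous_on {p..t} w"
    unfolding w_def
    by (intro continuous_intros continuous_on_subset[OF u_cont] continuous_on_subset[OF \<Phi>_cont]) auto
  then obtain y0 where y0: "y0 \<in> {p..t}" "\<And>y. y \<in> {p..t} \<Longrightarrow> w y0 \<le> w y"
    using continuous_attains_inf[of "{p..t}" w] assms by auto
  \<comment> \<open>The deficits push the minimum of \<open>w\<close> over \<open>{p..t}\<close> off
    both endpoints.\<close>
  have "w q < w p" using \<Phi>_left \<theta> by (simp add: w_def a'_def algebra_simps)
  moreover have "w r < w t" using \<Phi>_right \<theta> by (simp add: w_def b'_def algebra_simps)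
  ultimately have "y0 \<noteq> p" "y0 \<noteq> t" using y0(2)[of q] y0(2)[of r] assms by auto
  with y0 have y0_in: "y0 \<in> {p<..<t}" by auto
  then have "\<forall>\<^sub>F y in at y0. y \<in> {p<..<t}"
    by (intro eventually_at_in_open') auto
  then have ev: "\<forall>\<^sub>F y in at y0. u y - (\<Phi> y - c * y) \<ge> u y0 - (\<Phi> y0 - c * y0)"
    by eventually_elim (use y0(2) in \<open>auto simp: w_def\<close>)
  have "C1_test (\<lambda>y. \<Phi> y - c * y) (\<lambda>y. \<rho> y * s y - c)"
    unfolding C1_test_def
    by (auto intro!: derivative_eq_intros \<Phi> continuous_intros \<rho>_cont s_cont)
  \<comment> \<open>The test slope is \<open>\<rho> s - c\<close>, so the supersolution inequality
    would force \<open>\<bar>\<rho>\<bar> \<ge> 1\<close> wherever \<open>s > 0\<close>.\<close>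
  from touch_below[OF this ev] have "(\<rho> y0 * s y0)\<^sup>2 \<ge> (s y0)\<^sup>2"
    by (simp add: s_sq)
  then have "\<bar>s y0\<bar> \<le> \<bar>\<rho> y0\<bar> * \<bar>s y0\<bar>" by (simp add: abs_le_square_iff[symmetric] abs_mult)
  moreover have "s y0 > 0" using pos y0_in by auto
  ultimately have "1 \<le> \<bar>\<rho> y0\<bar>" by simp
  with \<rho>_abs[of y0] \<theta> show False by simp
qed

text \<open>If both equalities failed, continuity would keep the left deficit on
  \<open>{a..q}\<close> for some \<open>q < x\<close>. The gap between \<open>q\<close> and
  \<open>x\<close> is then the room that \<open>no_convex_kink\<close> needs.\<close>

lemma calibrated_one_side:
  assumes "a < x" "x < b" and pos: "\<And>y. a < y \<Longrightarrow> y < b \<Longrightarrow> s y > 0"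
  shows "u x - u a = S x - S a - c * (x - a) \<or> u b - u x = - (S b - S x) - c * (b - x)"
proof (rule ccontr)
  assume neg: "\<not> ?thesis"
  have S_cont: "continuous_on UNIV S"
    using S_deriv by (meson DERIV_isCont continuous_at_imp_continuous_on)
  have lim: "(f \<longlongrightarrow> f z) (at z within A)" if "continuous_on UNIV f" for f :: "real \<Rightarrow> real" and z A
    using that tendsto_within_subset[of f _ z UNIV A] by (simp add: continuous_on_def)
  let ?A = "\<lambda>p q. (S q - S p - c * (q - p)) - (u q - u p)"
  let ?B = "\<lambda>r t. (u t - u r) + (S t - S r) + c * (t - r)"
  have A: "?A a x > 0" and B: "?B x b > 0"
    using neg increment_le[of a x] increment_ge[of x b] assms by auto
  have "\<forall>\<^sub>F q in at_left x. ?A a q > 0"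
    by (rule order_tendstoD(1)[OF _ A]) (intro tendsto_intros lim u_cont S_cont)
  moreover have "\<forall>\<^sub>F q in at_left x. q \<in> {a<..<x}"
    by (rule eventually_at_leftI[of a]) (use assms in auto)
  ultimately have "\<forall>\<^sub>F q in at_left x. ?A a q > 0 \<and> q \<in> {a<..<x}"
    by (rule eventually_conj)
  then obtain q where q: "?A a q > 0" "a < q" "q < x"
    using eventually_happens'[OF trivial_limit_at_left_real] by fastforce
  show False
    by (rule no_convex_kink[of a q x b]) (use q B assms in auto)
qed

end

section \<open>Quadratic wells\<close>

text \<open>Rationalising bounds the difference of the roots by \<open>m / sqrt (2 * f + m)\<close>.
  The well that bounds \<open>f\<close> from below varies with \<open>t\<close>; summing over all
  wells gives one integrand with an explicit antiderivative.\<close>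

lemma sqrt_add_le_sum_wells:
  fixes f m \<kappa> t :: real
  assumes "f \<ge> 0" "m > 0" "\<kappa> > 0" "finite Z" "z \<in> Z" "f \<ge> \<kappa> * (t - z)\<^sup>2"
  shows "sqrt (2 * f + m) \<le> sqrt (2 * f) + (\<Sum>z\<in>Z. m / sqrt (2 * \<kappa> * (t - z)\<^sup>2 + m))"
proof -
  define r where "r = sqrt (2 * f + m)"
  have r: "r > 0" "r\<^sup>2 = 2 * f + m" using assms by (auto simp: r_def)
  have q: "sqrt (2 * f) \<ge> 0" "sqrt (2 * f) \<le> r" "(sqrt (2 * f))\<^sup>2 = 2 * f"
    using assms by (auto simp: r_def)
  have "sqrt (2 * f) * sqrt (2 * f) \<le> sqrt (2 * f) * r"
    using q by (intro mult_left_mono) auto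
  then have "(r - sqrt (2 * f)) * r \<le> m"
    using r(2) q(3) by (simp add: power2_eq_square algebra_simps)
  then have "r - sqrt (2 * f) \<le> m / r"
    using r(1) by (simp add: pos_le_divide_eq)
  also have "m / r \<le> m / sqrt (2 * \<kappa> * (t - z)\<^sup>2 + m)"
    unfolding r_def using assms by (intro divide_left_mono real_sqrt_le_mono mult_pos_pos) (auto intro: add_nonneg_pos)
  also have "\<dots> \<le> (\<Sum>z\<in>Z. m / sqrt (2 * \<kappa> * (t - z)\<^sup>2 + m))"
    using assms by (intro member_le_sum) (auto intro!: divide_nonneg_nonneg add_nonneg_nonneg)
  finally show ?thesis by (simp add: r_def)
qed

lemma arsinh_well_deriv:
  fixes m \<kappa> z :: real
  assumes "m > 0" "\<kappa> > 0"
  shows "((\<lambda>t. m / sqrt (2 * \<kappa>) * arsinh ((t - z) * sqrt (2 * \<kappa> / m))) has_real_derivative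
           m / sqrt (2 * \<kappa> * (t - z)\<^sup>2 + m)) (at t)"
proof -
  have "((t - z) * sqrt (2 * \<kappa> / m))\<^sup>2 + 1 = (2 * \<kappa> * (t - z)\<^sup>2 + m) / m"
    using assms by (simp add: power_mult_distrib add_divide_distrib)
  then have eq: "m / sqrt (2 * \<kappa>) * (sqrt (2 * \<kappa> / m) / sqrt (((t - z) * sqrt (2 * \<kappa> / m))\<^sup>2 + 1))
      = m / sqrt (2 * \<kappa> * (t - z)\<^sup>2 + m)"
    using assms by (simp add: real_sqrt_divide)
  have "((\<lambda>t. m / sqrt (2 * \<kappa>) * arsinh ((t - z) * sqrt (2 * \<kappa> / m))) has_real_derivative
           m / sqrt (2 * \<kappa>) * (sqrt (2 * \<kappa> / m) / sqrt (((t - z) * sqrt (2 * \<kappa> / m))\<^sup>2 + 1))) (at t)"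
    by (intro DERIV_cmult DERIV_cong[OF DERIV_chain2[OF arsinh_real_has_field_derivative]])
       (auto intro!: derivative_eq_intros)
  then show ?thesis unfolding eq .
qed

text \<open>Bounds the increment over \<open>{-1..2}\<close> of the summed arsinh antiderivatives
  with \<open>m = 2 * L * \<epsilon>\<close>. The 3 is the largest distance from a point to a well,
  the factor 2 accounts for the two endpoints.\<close>

definition well_error :: "real set \<Rightarrow> real \<Rightarrow> real \<Rightarrow> real \<Rightarrow> real" where
  "well_error Z \<kappa> L \<epsilon> =
     real (card Z) * (2 * (2 * L * \<epsilon> / sqrt (2 * \<kappa>) * arsinh (3 * sqrt (2 * \<kappa> / (2 * L * \<epsilon>)))))"

text \<open>The window \<open>{-1..2}\<close> holds every point within one period of
  \<open>{0..1}\<close>. By \<open>\<epsilon>_small\<close>, the increment of \<open>S\<close> over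
  a period, which is close to \<open>c0\<close>, still exceeds \<open>\<bar>c\<bar>\<close>.\<close>

locale discounted_wells = discounted_solution +
  fixes Z :: "real set" and \<kappa> b K L c0 :: real and R :: "real \<Rightarrow> real"
  assumes Z: "finite Z" "\<And>z. z \<in> Z \<Longrightarrow> F z = 0" "Z \<subseteq> {-1..2}"
    and \<kappa>_pos: "\<kappa> > 0"
    and coercive: "\<And>t. t \<in> {-1..2} \<Longrightarrow> \<exists>z\<in>Z. F t \<ge> \<kappa> * (t - z)\<^sup>2"
    and F_le: "\<And>x. F x \<le> b" and c_le: "\<bar>c\<bar> \<le> K"
    and L: "L = sqrt (2 * b + K\<^sup>2) + K" "L > 0"
    and R_deriv: "\<And>x. (R has_real_derivative sqrt (2 * F x)) (at x)"
    and R_period: "\<And>x. R (x + 1) - R x = c0"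
    and \<epsilon>_small: "2 * L / sqrt (2 * \<kappa>) * \<epsilon> < c0 - \<bar>c\<bar>"
begin

lemma u_lipschitz: "\<bar>u z - u x\<bar> \<le> L * \<bar>z - x\<bar>"
  using lipschitz[OF F_le c_le] by (simp add: L(1))

lemma u_le_dist: "z \<in> Z \<Longrightarrow> u t \<le> L * \<bar>t - z\<bar>"
  using u_lipschitz[of t z] u_nonpos[of z] Z(2)[of z] by linarith

text \<open>Only \<open>u t > 0\<close> costs anything. With \<open>a = sqrt (2 * F t)\<close>, the
  loss times \<open>a\<close> is at most \<open>2 * \<epsilon> * u t\<close>, and \<open>u t\<close>
  is at most \<open>L\<close> times the distance to a well, itself at most
  \<open>a / sqrt (2 * \<kappa>)\<close>. Cancelling \<open>a\<close> leaves a loss linear in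
  \<epsilon>, uniformly up to the wells.\<close>

lemma s_ge:
  assumes "t \<in> {-1..2}"
  shows "sqrt (2 * F t) - 2 * L / sqrt (2 * \<kappa>) * \<epsilon> \<le> s t"
proof (cases "u t \<le> 0")
  case True
  then have "\<epsilon> * u t \<le> 0" using \<epsilon>_pos by (simp add: mult_le_0_iff)
  then have "sqrt (2 * F t) \<le> s t" unfolding s_def by (intro real_sqrt_le_mono) simp
  moreover have "2 * L / sqrt (2 * \<kappa>) * \<epsilon> \<ge> 0" using L(2) \<kappa>_pos \<epsilon>_pos by simp
  ultimately show ?thesis by linarith
next
  case False
  define a where "a = sqrt (2 * F t)"
  have eu: "\<epsilon> * u t > 0" using False \<epsilon>_pos by simp
  then have "F t > 0" using F_ge[of t] by linarith
  then have a: "a > 0" "a\<^sup>2 = 2 * F t" by (auto simp: a_def)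
  have "s t \<le> a" unfolding s_def a_def using eu by (intro real_sqrt_le_mono) simp
  then have "s t * s t \<le> s t * a" using s_nonneg[of t] by (intro mult_left_mono) auto
  then have "(a - s t) * a \<le> a\<^sup>2 - (s t)\<^sup>2" by (simp add: power2_eq_square algebra_simps)
  also have "\<dots> = 2 * \<epsilon> * u t" by (simp add: a s_sq algebra_simps)
  finally have 1: "(a - s t) * a \<le> 2 * \<epsilon> * u t" .
  obtain z where z: "z \<in> Z" "F t \<ge> \<kappa> * (t - z)\<^sup>2" using coercive[OF assms] by blast
  have "sqrt (2 * \<kappa>) * \<bar>t - z\<bar> = sqrt (2 * \<kappa> * (t - z)\<^sup>2)" by (simp add: real_sqrt_mult)
  also have "\<dots> \<le> a" unfolding a_def using z by (intro real_sqrt_le_mono) simp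
  finally have "\<bar>t - z\<bar> \<le> a / sqrt (2 * \<kappa>)" using \<kappa>_pos by (simp add: field_simps)
  then have "u t \<le> L * (a / sqrt (2 * \<kappa>))"
    using u_le_dist[OF z(1), of t] L(2) by (smt (verit) mult_left_mono)
  then have "2 * \<epsilon> * u t \<le> 2 * \<epsilon> * (L * (a / sqrt (2 * \<kappa>)))"
    using \<epsilon>_pos by (intro mult_left_mono) auto
  with 1 have "(a - s t) * a \<le> (2 * L / sqrt (2 * \<kappa>) * \<epsilon>) * a" by (simp add: algebra_simps)
  then have "a - s t \<le> 2 * L / sqrt (2 * \<kappa>) * \<epsilon>" using a(1) by (simp only: mult_le_cancel_right_pos)
  then show ?thesis by (simp add: a_def)
qed

lemma S_increment_ge:
  assumes "-1 \<le> x" "x \<le> z" "z \<le> 2" "z - x \<le> 1"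
  shows "S z - S x \<ge> R z - R x - 2 * L / sqrt (2 * \<kappa>) * \<epsilon>"
proof -
  define C where "C = 2 * L / sqrt (2 * \<kappa>) * \<epsilon>"
  have C: "C \<ge> 0" using L(2) \<kappa>_pos \<epsilon>_pos by (simp add: C_def)
  have "(R z - C * z) - (R x - C * x) \<le> S z - S x"
  proof (rule mono_increment[OF _ S_deriv])
    show "((\<lambda>z. R z - C * z) has_real_derivative sqrt (2 * F t) - C) (at t)" for t
      by (auto intro!: derivative_eq_intros R_deriv)
    show "sqrt (2 * F t) - C \<le> s t" if "x \<le> t" "t \<le> z" for t
      using s_ge[of t] that assms by (simp add: C_def)
  qed (use assms in auto)
  moreover have "C * (z - x) \<le> C * 1" using C assms by (intro mult_left_mono) auto
  ultimately show ?thesis unfolding C_def[symmetric] by (simp add: algebra_simps)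
qed

text \<open>The search stops after one period; the alternative \<open>a = x - 1\<close> is excluded
  later by periodicity of \<open>u\<close>.\<close>

lemma last_zero_left:
  assumes "s x > 0"
  obtains a where "x - 1 \<le> a" "a < x" "s a = 0 \<or> a = x - 1" "\<And>y. a < y \<Longrightarrow> y \<le> x \<Longrightarrow> s y > 0"
proof (cases "\<exists>y\<in>{x-1..x}. s y = 0")
  case True
  let ?T = "{x-1..x} \<inter> s -` {0}"
  have "compact ?T"
    by (intro compact_Int_closed compact_Icc continuous_closed_vimage)
       (use s_cont in \<open>auto simp: continuous_on_eq_continuous_at\<close>)
  moreover have "?T \<noteq> {}" using True by auto
  ultimately obtain a where a: "a \<in> ?T" "\<And>y. y \<in> ?T \<Longrightarrow> y \<le> a"
    using compact_attains_sup[of ?T] by blast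
  show thesis
  proof (rule that)
    show "a < x" using a(1) assms by (cases "a = x") auto
    show "s y > 0" if "a < y" "y \<le> x" for y
      using a(1) a(2)[of y] that s_nonneg[of y] by (cases "s y = 0") auto
  qed (use a in auto)
next
  case False
  show thesis
  proof (rule that[of "x - 1"])
    show "s y > 0" if "x - 1 < y" "y \<le> x" for y
      using that False s_nonneg[of y] by (cases "s y = 0") (auto simp: less_le)
  qed auto
qed

lemma first_zero_right:
  assumes "s x > 0"
  obtains a where "a \<le> x + 1" "x < a" "s a = 0 \<or> a = x + 1" "\<And>y. x \<le> y \<Longrightarrow> y < a \<Longrightarrow> s y > 0"
proof (cases "\<exists>y\<in>{x..x+1}. s y = 0")
  case True
  let ?T = "{x..x+1} \<inter> s -` {0}"
  have "compact ?T"
    by (intro compact_Int_closed compact_Icc continuous_closed_vimage)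
       (use s_cont in \<open>auto simp: continuous_on_eq_continuous_at\<close>)
  moreover have "?T \<noteq> {}" using True by auto
  ultimately obtain a where a: "a \<in> ?T" "\<And>y. y \<in> ?T \<Longrightarrow> a \<le> y"
    using compact_attains_inf[of ?T] by blast
  show thesis
  proof (rule that)
    show "x < a" using a(1) assms by (cases "a = x") auto
    show "s y > 0" if "x \<le> y" "y < a" for y
      using a(1) a(2)[of y] that s_nonneg[of y] by (cases "s y = 0") auto
  qed (use a in auto)
next
  case False
  show thesis
  proof (rule that[of "x + 1"])
    show "s y > 0" if "x \<le> y" "y < x + 1" for y
      using that False s_nonneg[of y] by (cases "s y = 0") (auto simp: less_le)
  qed auto
qed

text \<open>On a calibrated side reaching a full period, \<open>u\<close> returns to its value, so
  \<open>S\<close> would grow over that period by exactly \<open>c\<close> or \<open>-c\<close>.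
  That is less than the growth guaranteed by \<open>S_increment_ge\<close> and
  \<open>\<epsilon>_small\<close>, so a zero of \<open>s\<close> comes first.\<close>

lemma source_exists:
  assumes x: "x \<in> {0..1}"
  obtains y where "s y = 0" "x - 1 \<le> y" "y \<le> x" "u x - u y = S x - S y - c * (x - y)"
  | y where "s y = 0" "x \<le> y" "y \<le> x + 1" "u y - u x = - (S y - S x) - c * (y - x)"
proof (cases "s x = 0")
  case True
  then show thesis using that(1)[of x] by simp
next
  case False
  then have sx: "s x > 0" using s_nonneg[of x] by simp
  obtain a where a: "x - 1 \<le> a" "a < x" "s a = 0 \<or> a = x - 1" "\<And>y. a < y \<Longrightarrow> y \<le> x \<Longrightarrow> s y > 0"
    using last_zero_left[OF sx] by blast
  obtain d where d: "d \<le> x + 1" "x < d" "s d = 0 \<or> d = x + 1" "\<And>y. x \<le> y \<Longrightarrow> y < d \<Longrightarrow> s y > 0"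
    using first_zero_right[OF sx] by blast
  have per: "u (x - 1) = u x" "u (x + 1) = u x"
    using u_per periodic1_add_int[OF u_per, of x "-1"] by (auto simp: periodic1_def)
  have "s y > 0" if "a < y" "y < d" for y
    using a(4)[of y] d(4)[of y] that by (cases "y \<le> x") auto
  then consider "u x - u a = S x - S a - c * (x - a)" | "u d - u x = - (S d - S x) - c * (d - x)"
    using calibrated_one_side[OF a(2) d(2)] by blast
  then show thesis
  proof cases
    case 1
    have "s a = 0"
    proof (rule ccontr)
      assume "s a \<noteq> 0"
      then have "a = x - 1" using a(3) by auto
      then have "S x - S (x - 1) = c" using 1 per by simp
      moreover have "S x - S (x - 1) \<ge> R x - R (x - 1) - 2 * L / sqrt (2 * \<kappa>) * \<epsilon>"
        using x by (intro S_increment_ge) auto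
      ultimately show False using R_period[of "x - 1"] \<epsilon>_small by simp
    qed
    then show thesis using that(1)[of a] a 1 by simp
  next
    case 2
    have "s d = 0"
    proof (rule ccontr)
      assume "s d \<noteq> 0"
      then have "d = x + 1" using d(3) by auto
      then have "S (x + 1) - S x = - c" using 2 per by simp
      moreover have "S (x + 1) - S x \<ge> R (x + 1) - R x - 2 * L / sqrt (2 * \<kappa>) * \<epsilon>"
        using x by (intro S_increment_ge) auto
      ultimately show False using R_period[of x] \<epsilon>_small by simp
    qed
    then show thesis using that(2)[of d] d 2 by simp
  qed
qed

lemma u_nonneg_source: "s y = 0 \<Longrightarrow> u y \<ge> 0"
proof -
  assume "s y = 0"
  then have "\<epsilon> * u y = F y" using s_sq[of y] by simp
  then show ?thesis using F_nonneg[of y] \<epsilon>_pos by (metis zero_le_mult_iff not_less)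
qed

text \<open>At a zero of \<open>s\<close>, \<open>F = \<epsilon> u\<close>: quadratic growth of
  \<open>F\<close> meets linear growth of \<open>u\<close> away from the well, and one factor of the
  distance cancels.\<close>

lemma source_near_zero:
  assumes "s y = 0" "y \<in> {-1..2}"
  obtains z where "z \<in> Z" "\<bar>y - z\<bar> \<le> L / \<kappa> * \<epsilon>"
proof -
  obtain z where z: "z \<in> Z" "F y \<ge> \<kappa> * (y - z)\<^sup>2" using coercive[OF assms(2)] by blast
  have "F y = \<epsilon> * u y" using s_sq[of y] assms(1) by simp
  also have "\<dots> \<le> \<epsilon> * (L * \<bar>y - z\<bar>)" using u_le_dist[OF z(1)] \<epsilon>_pos by simp
  finally have "\<kappa> * \<bar>y - z\<bar> * \<bar>y - z\<bar> \<le> \<epsilon> * L * \<bar>y - z\<bar>"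
    using z(2) by (simp add: power2_eq_square algebra_simps flip: abs_mult)
  then have "\<kappa> * \<bar>y - z\<bar> \<le> \<epsilon> * L"
    using \<epsilon>_pos L(2) by (cases "y = z") (auto simp: mult_le_cancel_right)
  then have "\<bar>y - z\<bar> \<le> L / \<kappa> * \<epsilon>" using \<kappa>_pos by (simp add: field_simps)
  with z(1) show thesis by (rule that)
qed

text \<open>Unlike \<open>\<epsilon>_u_ge\<close>, this bound does not degenerate as \<epsilon>
  tends to 0: a source, where \<open>u\<close> is nonnegative, lies within distance 1, and
  \<open>u\<close> is \<open>L\<close>-Lipschitz.\<close>

lemma u_ge: "u x \<ge> - L"
proof -
  have f: "frac x \<in> {0..1}" using frac_ge_0[of x] frac_lt_1[of x] by auto
  have "\<exists>y. s y = 0 \<and> \<bar>frac x - y\<bar> \<le> 1"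
    using f by (rule source_exists) (auto simp: abs_le_iff)
  then obtain y where y: "s y = 0" "\<bar>frac x - y\<bar> \<le> 1" by blast
  have "u y - u (frac x) \<le> L * \<bar>y - frac x\<bar>" using u_lipschitz[of y "frac x"] by linarith
  also have "\<dots> \<le> L * 1" using y(2) L(2) by (intro mult_left_mono) auto
  finally show ?thesis using u_nonneg_source[OF y(1)] periodic1_frac[OF u_per, of x] by simp
qed

lemma S_increment_le:
  assumes "-1 \<le> x" "x \<le> z" "z \<le> 2"
  shows "S z - S x \<le> R z - R x + well_error Z \<kappa> L \<epsilon>"
proof -
  \<comment> \<open>Since \<open>u \<ge> -L\<close>, the radicand of \<open>s\<close> is at most
    \<open>2 * F + m\<close>.\<close>
  define m where "m = 2 * L * \<epsilon>"
  have m: "m > 0" using L(2) \<epsilon>_pos by (simp add: m_def)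
  define g where "g w t = m / sqrt (2 * \<kappa>) * arsinh ((t - w) * sqrt (2 * \<kappa> / m))" for w t
  define P where "P t = (\<Sum>w\<in>Z. g w t)" for t
  have P: "(P has_real_derivative (\<Sum>w\<in>Z. m / sqrt (2 * \<kappa> * (t - w)\<^sup>2 + m))) (at t)" for t
    unfolding P_def g_def by (intro DERIV_sum arsinh_well_deriv m \<kappa>_pos)
  have "S z - S x \<le> (R z + P z) - (R x + P x)"
  proof (rule mono_increment[OF S_deriv])
    show "((\<lambda>z. R z + P z) has_real_derivative
        sqrt (2 * F t) + (\<Sum>w\<in>Z. m / sqrt (2 * \<kappa> * (t - w)\<^sup>2 + m))) (at t)" for t
      by (intro derivative_intros R_deriv P)
    show "s t \<le> sqrt (2 * F t) + (\<Sum>w\<in>Z. m / sqrt (2 * \<kappa> * (t - w)\<^sup>2 + m))" if "x \<le> t" "t \<le> z" for t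
    proof -
      have "t \<in> {-1..2}" using that assms by auto
      then obtain w where w: "w \<in> Z" "F t \<ge> \<kappa> * (t - w)\<^sup>2" using coercive by blast
      have "\<epsilon> * u t \<ge> \<epsilon> * (- L)" using u_ge[of t] \<epsilon>_pos by (intro mult_left_mono) auto
      then have "s t \<le> sqrt (2 * F t + m)"
        unfolding s_def m_def by (intro real_sqrt_le_mono) (simp add: algebra_simps)
      also have "\<dots> \<le> sqrt (2 * F t) + (\<Sum>w\<in>Z. m / sqrt (2 * \<kappa> * (t - w)\<^sup>2 + m))"
        using F_nonneg m \<kappa>_pos Z(1) w by (rule sqrt_add_le_sum_wells)
      finally show ?thesis .
    qed
  qed (use assms in auto)
  moreover have "P z - P x \<le> well_error Z \<kappa> L \<epsilon>"
  proof -
    define A where "A = m / sqrt (2 * \<kappa>) * arsinh (3 * sqrt (2 * \<kappa> / m))"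
    have g_abs: "\<bar>g w t\<bar> \<le> A"
      if "w \<in> Z" "t \<in> {-1..2}" for w t
    proof -
      have "\<bar>(t - w) * sqrt (2 * \<kappa> / m)\<bar> \<le> 3 * sqrt (2 * \<kappa> / m)"
        using that Z(3) m \<kappa>_pos by (auto simp: abs_mult abs_le_iff intro!: mult_right_mono)
      moreover have "\<bar>arsinh q\<bar> = arsinh \<bar>q\<bar>" for q :: real
        by (cases "q \<ge> 0") (auto simp: abs_if not_le)
      ultimately have "\<bar>arsinh ((t - w) * sqrt (2 * \<kappa> / m))\<bar> \<le> arsinh (3 * sqrt (2 * \<kappa> / m))"
        by (metis arsinh_less_iff_real not_le)
      then show ?thesis
        using m \<kappa>_pos unfolding g_def A_def by (simp add: abs_mult divide_right_mono mult_left_mono)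
    qed
    have "P z - P x = (\<Sum>w\<in>Z. g w z - g w x)" by (simp add: P_def sum_subtractf)
    also have "\<dots> \<le> (\<Sum>w\<in>Z. 2 * A)"
    proof (rule sum_mono)
      fix w assume "w \<in> Z"
      then show "g w z - g w x \<le> 2 * A"
        using g_abs[of w z] g_abs[of w x] assms by simp
    qed
    also have "\<dots> = well_error Z \<kappa> L \<epsilon>" by (simp add: well_error_def m_def A_def)
    finally show ?thesis .
  qed
  ultimately show ?thesis by linarith
qed

end

text \<open>On the segment joining \<open>x\<close> to its source \<open>y\<close> the increment of
  \<open>u\<close> is an equality and that of \<open>w\<close> an inequality of the same form, so
  the terms in \<open>c\<close> and \<open>R\<close> cancel. What remains is
  \<open>w y - u y\<close> and the two errors. The side supplying the segment pays only
  O(\<epsilon>); the logarithm falls on \<eta>.\<close>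

lemma discounted_comparison:
  assumes u: "discounted_wells F \<epsilon> c u s S Z \<kappa> b K L c0 R"
    and w: "discounted_wells F \<eta> c w s' S' Z \<kappa> b K L c0 R"
    and x: "x \<in> {0..1}"
  shows "w x \<le> u x + (2 * L / sqrt (2 * \<kappa>) + L\<^sup>2 / \<kappa>) * \<epsilon> + well_error Z \<kappa> L \<eta>"
proof -
  interpret u: discounted_wells F \<epsilon> c u s S Z \<kappa> b K L c0 R by (rule u)
  interpret w: discounted_wells F \<eta> c w s' S' Z \<kappa> b K L c0 R by (rule w)
  have wy: "w y \<le> L\<^sup>2 / \<kappa> * \<epsilon>" if "s y = 0" "y \<in> {-1..2}" for y
  proof -
    obtain z where z: "z \<in> Z" "\<bar>y - z\<bar> \<le> L / \<kappa> * \<epsilon>" using u.source_near_zero[OF \<open>s y = 0\<close> \<open>y \<in> {-1..2}\<close>] by blast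
    have "w y \<le> L * \<bar>y - z\<bar>" using w.u_le_dist z(1) by simp
    also have "\<dots> \<le> L * (L / \<kappa> * \<epsilon>)" using z(2) u.L(2) by (intro mult_left_mono) auto
    finally show ?thesis by (simp add: power2_eq_square)
  qed
  from x show ?thesis
  proof (rule u.source_exists)
    fix y assume y: "s y = 0" "x - 1 \<le> y" "y \<le> x" "u x - u y = S x - S y - c * (x - y)"
    have "w x - w y \<le> S' x - S' y - c * (x - y)" using w.increment_le y by blast
    moreover have "S' x - S' y \<le> R x - R y + well_error Z \<kappa> L \<eta>" using w.S_increment_le y x by auto
    moreover have "S x - S y \<ge> R x - R y - 2 * L / sqrt (2 * \<kappa>) * \<epsilon>" using u.S_increment_ge y x by auto
    moreover have "w y \<le> L\<^sup>2 / \<kappa> * \<epsilon>" using wy y x by auto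
    ultimately show ?thesis
      using y(4) u.u_nonneg_source[OF y(1)] unfolding distrib_right by linarith
  next
    fix y assume y: "s y = 0" "x \<le> y" "y \<le> x + 1" "u y - u x = - (S y - S x) - c * (y - x)"
    have "w y - w x \<ge> - (S' y - S' x) - c * (y - x)" using w.increment_ge y by blast
    moreover have "S' y - S' x \<le> R y - R x + well_error Z \<kappa> L \<eta>" using w.S_increment_le y x by auto
    moreover have "S y - S x \<ge> R y - R x - 2 * L / sqrt (2 * \<kappa>) * \<epsilon>" using u.S_increment_ge y x by auto
    moreover have "w y \<le> L\<^sup>2 / \<kappa> * \<epsilon>" using wy y x by auto
    ultimately show ?thesis
      using y(4) u.u_nonneg_source[OF y(1)] unfolding distrib_right by linarith
  qed
qed

section \<open>Estimates of the logarithmic error\<close>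

lemma log_term_le:
  fixes \<epsilon> :: real
  assumes "0 < \<epsilon>" "\<epsilon> \<le> 1"
  shows "\<epsilon> * \<bar>ln \<epsilon>\<bar> \<le> sqrt \<epsilon>"
proof -
  define y where "y = 1 / sqrt \<epsilon>"
  have y: "y > 0" using assms by (simp add: y_def)
  \<comment> \<open>Applying the tangent bound at \<open>y / 2\<close> rather than \<open>y\<close>
    gains the factor 2 in \<open>2 * ln y \<le> y\<close>.\<close>
  have "ln (y / 2) \<le> y / 2 - 1" using y by (intro ln_le_minus_one) simp
  moreover have "ln (2::real) \<le> 2 - 1" by (rule ln_le_minus_one) simp
  ultimately have "2 * ln y \<le> y" using y by (simp add: ln_div)
  moreover have "\<bar>ln \<epsilon>\<bar> = 2 * ln y" using assms by (simp add: y_def ln_div ln_sqrt)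
  ultimately have "\<epsilon> * \<bar>ln \<epsilon>\<bar> \<le> \<epsilon> * y" using assms by simp
  also have "\<epsilon> * y = sqrt \<epsilon>" using assms by (simp add: y_def real_div_sqrt)
  finally show ?thesis .
qed

text \<open>Either \<open>d\<close> already dominates the left side, or
  \<open>d < sqrt \<epsilon>\<close> and so
  \<open>\<bar>ln \<epsilon>\<bar> \<le> 2 * \<bar>ln d\<bar>\<close>. In the latter case
  \<open>\<bar>ln \<epsilon>\<bar> \<ge> 1\<close> allows squaring, whence the factor 4.\<close>

lemma log_term_le_any_cutoff:
  fixes \<epsilon> d :: real
  assumes "0 < \<epsilon>" "\<epsilon> \<le> exp (-1)" "0 < d"
  shows "\<epsilon> * \<bar>ln \<epsilon>\<bar> \<le> 4 * (\<epsilon> * \<bar>ln d\<bar>\<^sup>2 + d)"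
proof (cases "d \<ge> \<epsilon> * \<bar>ln \<epsilon>\<bar>")
  case True
  define q where "q = \<epsilon> * \<bar>ln d\<bar>\<^sup>2"
  have "q \<ge> 0" using assms by (simp add: q_def)
  then have "d \<le> 4 * (q + d)" using assms(3) by simp
  with True show ?thesis unfolding q_def by (rule order_trans)
next
  case False
  have "ln \<epsilon> \<le> ln (exp (-1))" using assms by (intro ln_mono) auto
  then have l: "ln \<epsilon> \<le> -1" by simp
  have "\<epsilon> \<le> 1" using assms exp_le_one_iff[of "-1::real"] by (meson order_trans neg_le_0_iff_le zero_le_one)
  with False log_term_le[of \<epsilon>] assms have "d \<le> sqrt \<epsilon>" by linarith
  then have "ln d \<le> ln (sqrt \<epsilon>)" using assms by (intro ln_mono) auto
  then have "ln d \<le> ln \<epsilon> / 2" using assms by (simp add: ln_sqrt)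
  then have "\<bar>ln \<epsilon>\<bar> \<le> 2 * \<bar>ln d\<bar>" using l by linarith
  then have "\<bar>ln \<epsilon>\<bar>\<^sup>2 \<le> (2 * \<bar>ln d\<bar>)\<^sup>2" by (intro power_mono) auto
  moreover have "\<bar>ln \<epsilon>\<bar> * 1 \<le> \<bar>ln \<epsilon>\<bar> * \<bar>ln \<epsilon>\<bar>" using l by (intro mult_left_mono) auto
  ultimately have "\<bar>ln \<epsilon>\<bar> \<le> 4 * \<bar>ln d\<bar>\<^sup>2" by (simp add: power2_eq_square)
  then have "\<epsilon> * \<bar>ln \<epsilon>\<bar> \<le> \<epsilon> * (4 * \<bar>ln d\<bar>\<^sup>2)" using assms by (intro mult_left_mono) auto
  also have "\<dots> \<le> 4 * (\<epsilon> * \<bar>ln d\<bar>\<^sup>2 + d)" using assms(3) by simp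
  finally show ?thesis .
qed

text \<open>The arsinh is at most \<open>ln (2 * r + 1)\<close> with \<open>r\<close> of order
  \<eta> to the power -1/2, hence at most \<open>ln (1 / \<eta>)\<close> for small \<eta>.\<close>

lemma well_error_le:
  fixes \<kappa> L :: real
  assumes "\<kappa> > 0" "L > 0"
  shows "\<forall>\<^sub>F \<eta> in at_right 0.
    well_error Z \<kappa> L \<eta> \<le> real (card Z) * (4 * L / sqrt (2 * \<kappa>)) * (\<eta> * \<bar>ln \<eta>\<bar>)"
proof -
  \<comment> \<open>This expression is \<open>(2 * r + 1) * \<eta>\<close> for the \<open>r\<close>
    introduced below.\<close>
  have "((\<lambda>\<eta>. 6 * sqrt (\<kappa> / L * \<eta>) + \<eta>) \<longlongrightarrow> 6 * sqrt (\<kappa> / L * 0) + 0) (at_right 0)"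
    by (intro tendsto_intros)
  then have "\<forall>\<^sub>F \<eta> in at_right 0. 6 * sqrt (\<kappa> / L * \<eta>) + \<eta> < 1"
    by (rule order_tendstoD(2)) simp
  moreover have "\<forall>\<^sub>F \<eta> in at_right (0::real). \<eta> \<in> {0<..<1}"
    by (rule eventually_at_rightI[of _ 1]) auto
  ultimately show ?thesis
  proof eventually_elim
    case (elim \<eta>)
    then have \<eta>: "0 < \<eta>" "\<eta> < 1" by auto
    define r where "r = 3 * sqrt (2 * \<kappa> / (2 * L * \<eta>))"
    have r: "r \<ge> 0" using assms \<eta> by (simp add: r_def)
    have "r * \<eta> = 3 * sqrt (\<kappa> / (L * \<eta>)) * sqrt (\<eta>\<^sup>2)" using \<eta> by (simp add: r_def)
    also have "\<dots> = 3 * sqrt (\<kappa> / (L * \<eta>) * \<eta>\<^sup>2)" by (simp only: real_sqrt_mult mult.assoc)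
    also have "\<kappa> / (L * \<eta>) * \<eta>\<^sup>2 = \<kappa> / L * \<eta>" using \<eta> assms by (simp add: power2_eq_square)
    finally have "(2 * r + 1) * \<eta> \<le> 1" using elim by (simp add: algebra_simps)
    then have r1: "2 * r + 1 \<le> 1 / \<eta>" using \<eta> by (simp add: pos_le_divide_eq)
    have "sqrt (r\<^sup>2 + 1) \<le> r + 1" using r by (intro real_le_lsqrt) (auto simp: power2_eq_square algebra_simps)
    then have "arsinh r \<le> ln (1 / \<eta>)"
      unfolding arsinh_real_def using r r1 arsinh_real_aux[of r] by (intro ln_mono) auto
    also have "\<dots> = \<bar>ln \<eta>\<bar>" using \<eta> by (simp add: ln_div)
    finally have "real (card Z) * (4 * L / sqrt (2 * \<kappa>)) * \<eta> * arsinh r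
        \<le> real (card Z) * (4 * L / sqrt (2 * \<kappa>)) * \<eta> * \<bar>ln \<eta>\<bar>"
      using assms \<eta> by (intro mult_left_mono) auto
    then show ?case unfolding well_error_def r_def[symmetric] by (simp add: mult_ac)
  qed
qed

section \<open>Growth of the potential\<close>

text \<open>A zero of a nonnegative function is a minimum, so the first-order Taylor term vanishes.
  The quarter is the Taylor half times the half lost in keeping \<open>F''\<close> above
  \<open>F'' z / 2\<close> nearby.\<close>

lemma quadratic_lower_bound_at_zero:
  fixes F F' F'' :: "real \<Rightarrow> real"
  assumes d1: "\<And>x. (F has_real_derivative F' x) (at x)"
    and d2: "\<And>x. (F' has_real_derivative F'' x) (at x)"
    and cont: "continuous_on UNIV F''" and nonneg: "\<And>x. F x \<ge> 0"
    and z: "F z = 0" "F'' z > 0"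
  obtains d where "d > 0" "\<And>t. \<bar>t - z\<bar> < d \<Longrightarrow> F t \<ge> F'' z / 4 * (t - z)\<^sup>2"
proof -
  have "F' z = 0"
    by (rule DERIV_local_min[OF d1, of 1]) (use nonneg z in auto)
  have "isCont F'' z" using cont by (simp add: continuous_on_eq_continuous_at)
  then have "\<forall>\<^sub>F t in at z. F'' t > F'' z / 2"
    unfolding isCont_def by (rule order_tendstoD) (use z in simp)
  then obtain d where d: "d > 0" "\<And>t. t \<noteq> z \<Longrightarrow> dist t z < d \<Longrightarrow> F'' t > F'' z / 2"
    by (auto simp: eventually_at)
  have "F t \<ge> F'' z / 4 * (t - z)\<^sup>2" if t: "\<bar>t - z\<bar> < d" for t
  proof (cases "t = z")
    case False
    define diff where "diff n = (if n = 0 then F else if n = 1 then F' else F'')" for n :: nat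
    have "\<exists>y. (if t < z then t < y \<and> y < z else z < y \<and> y < t) \<and>
        F t = (\<Sum>m<2. diff m z / fact m * (t - z) ^ m) + diff 2 y / fact 2 * (t - z) ^ 2"
      by (rule Taylor[of 2 diff F "min t z" "max t z"])
         (use d1 d2 False in \<open>auto simp: diff_def less_2_cases_iff\<close>)
    then obtain y where y: "if t < z then t < y \<and> y < z else z < y \<and> y < t"
      "F t = F'' y / 2 * (t - z)\<^sup>2"
      using z \<open>F' z = 0\<close> by (auto simp: diff_def numeral_2_eq_2)
    have "F'' y > F'' z / 2"
      using y(1) t by (intro d) (auto simp: dist_real_def split: if_splits)
    then have "F'' z / 4 * (t - z)\<^sup>2 \<le> F'' y / 2 * (t - z)\<^sup>2" by (intro mult_right_mono) auto
    then show ?thesis using y(2) by simp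
  qed (use z in auto)
  with d(1) show thesis by (rule that)
qed

text \<open>Bisection replaces a covering argument: a local \<kappa> comes from Taylor expansion at
  a zero or from positivity elsewhere, and adjacent intervals merge with the smaller
  constant.\<close>

lemma quadratic_wells:
  fixes F F' F'' :: "real \<Rightarrow> real"
  assumes d1: "\<And>x. (F has_real_derivative F' x) (at x)"
    and d2: "\<And>x. (F' has_real_derivative F'' x) (at x)"
    and cont: "continuous_on UNIV F''" and nonneg: "\<And>x. F x \<ge> 0"
    and nondeg: "\<And>x. F x = 0 \<Longrightarrow> F'' x > 0"
    and z0: "z0 \<in> {a..b}" "F z0 = 0"
  obtains \<kappa> where "\<kappa> > 0" "\<And>t. t \<in> {a..b} \<Longrightarrow> \<exists>z\<in>{x\<in>{a..b}. F x = 0}. F t \<ge> \<kappa> * (t - z)\<^sup>2"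
proof -
  let ?Z = "{x\<in>{a..b}. F x = 0}"
  \<comment> \<open>Small intervals around an endpoint may stick out of \<open>{a..b}\<close>, hence
    the intersection.\<close>
  define P where "P p q \<longleftrightarrow> (\<exists>\<kappa>>0. \<forall>t\<in>{p..q} \<inter> {a..b}. \<exists>z\<in>?Z. F t \<ge> \<kappa> * (t - z)\<^sup>2)" for p q
  have "a \<le> b" using z0 by auto
  then have "P a b"
  proof (induction rule: Bolzano)
    case (trans p q r)
    obtain k1 where k1: "k1 > 0" "\<And>t. t \<in> {p..q} \<inter> {a..b} \<Longrightarrow> \<exists>z\<in>?Z. F t \<ge> k1 * (t - z)\<^sup>2"
      using trans(1) unfolding P_def by blast
    obtain k2 where k2: "k2 > 0" "\<And>t. t \<in> {q..r} \<inter> {a..b} \<Longrightarrow> \<exists>z\<in>?Z. F t \<ge> k2 * (t - z)\<^sup>2"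
      using trans(2) unfolding P_def by blast
    have "\<exists>z\<in>?Z. F t \<ge> min k1 k2 * (t - z)\<^sup>2" if "t \<in> {p..r} \<inter> {a..b}" for t
    proof -
      have le: "min k1 k2 * (t - z)\<^sup>2 \<le> k1 * (t - z)\<^sup>2" "min k1 k2 * (t - z)\<^sup>2 \<le> k2 * (t - z)\<^sup>2" for z
        by (auto intro!: mult_right_mono)
      show ?thesis
        using k1(2)[of t] k2(2)[of t] that le by (cases "t \<le> q") (auto intro: order_trans)
    qed
    then show ?case unfolding P_def using k1(1) k2(1) by (intro exI[of _ "min k1 k2"]) auto
  next
    case (local x)
    show ?case
    proof (cases "F x = 0")
      case True
      obtain d where d: "d > 0" "\<And>t. \<bar>t - x\<bar> < d \<Longrightarrow> F t \<ge> F'' x / 4 * (t - x)\<^sup>2"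
        using quadratic_lower_bound_at_zero[OF d1 d2 cont nonneg True nondeg[OF True]] by blast
      have "P p q" if "p \<le> x" "x \<le> q" "q - p < d" for p q
        unfolding P_def using local True nondeg[OF True] that
        by (intro exI[of _ "F'' x / 4"] conjI ballI bexI[of _ x] d(2)) auto
      with d(1) show ?thesis by blast
    next
      case False
      then have Fx: "F x > 0" using nonneg[of x] by simp
      have "isCont F x" using d1 by (rule DERIV_isCont)
      then have "\<forall>\<^sub>F t in at x. F t > F x / 2"
        unfolding isCont_def by (rule order_tendstoD) (use Fx in simp)
      then obtain d where d: "d > 0" "\<And>t. t \<noteq> x \<Longrightarrow> dist t x < d \<Longrightarrow> F t > F x / 2"
        by (auto simp: eventually_at)
      \<comment> \<open>Away from zeros the fixed zero \<open>z0\<close> serves as the well;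
        dividing by \<open>(b - a + 1)\<^sup>2\<close> keeps the parabola below
        \<open>F x / 2\<close> on all of \<open>{a..b}\<close>.\<close>
      define \<kappa> where "\<kappa> = F x / 2 / (b - a + 1)\<^sup>2"
      have \<kappa>: "\<kappa> > 0" using Fx \<open>a \<le> b\<close> by (simp add: \<kappa>_def)
      have "P p q" if pq: "p \<le> x" "x \<le> q" "q - p < d" for p q
        unfolding P_def
      proof (intro exI[of _ \<kappa>] conjI ballI \<kappa> bexI[of _ z0])
        fix t assume t: "t \<in> {p..q} \<inter> {a..b}"
        have "\<bar>t - z0\<bar> \<le> \<bar>b - a + 1\<bar>" using t z0 by auto
        then have "(t - z0)\<^sup>2 \<le> (b - a + 1)\<^sup>2" by (simp only: abs_le_square_iff)
        then have "\<kappa> * (t - z0)\<^sup>2 \<le> \<kappa> * (b - a + 1)\<^sup>2" using \<kappa> by (intro mult_left_mono) auto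
        also have "\<dots> = F x / 2" using \<open>a \<le> b\<close> by (simp add: \<kappa>_def)
        also have "\<dots> \<le> F t"
        proof (cases "t = x")
          case False
          moreover have "dist t x < d" using t pq by (auto simp: dist_real_def)
          ultimately show ?thesis using d(2) by (intro less_imp_le)
        qed (use Fx in simp)
        finally show "\<kappa> * (t - z0)\<^sup>2 \<le> F t" .
      qed (use z0 in auto)
      with d(1) show ?thesis by blast
    qed
  qed
  then show thesis using that unfolding P_def by auto
qed

lemma finite_periodic_zeros:
  assumes per: "periodic1 F" and fin: "finite {x\<in>{0..<1}. F x = (0::real)}"
  shows "finite {x\<in>{-1..2}. F x = 0}"
proof -
  have "{x\<in>{-1..2}. F x = 0} \<subseteq> (\<lambda>(k, x). x + of_int k) ` ({-1..2::int} \<times> {x\<in>{0..<1}. F x = 0})"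
  proof
    fix x assume x: "x \<in> {x\<in>{-1..2}. F x = 0}"
    have "\<lfloor>x\<rfloor> \<in> {-1..2}" using x by (auto simp: le_floor_iff floor_le_iff)
    moreover have "frac x \<in> {x\<in>{0..<1}. F x = 0}"
      using x periodic1_frac[OF per, of x] frac_lt_1[of x] by auto
    moreover have "x = frac x + of_int \<lfloor>x\<rfloor>" by (simp add: frac_def)
    ultimately show "x \<in> (\<lambda>(k, x). x + of_int k) ` ({-1..2::int} \<times> {x\<in>{0..<1}. F x = 0})"
      by (intro image_eqI[of _ _ "(\<lfloor>x\<rfloor>, frac x)"]) auto
  qed
  then show ?thesis by (rule finite_subset) (use fin in auto)
qed

lemma antiderivative_period:
  fixes f R :: "real \<Rightarrow> real"
  assumes "periodic1 f" "\<And>x. (R has_real_derivative f x) (at x)"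
  shows "R (x + 1) - R x = integral {0..1} f"
proof -
  have "((\<lambda>x. R (x + 1) - R x) has_real_derivative 0) (at x)" for x
  proof -
    have "((\<lambda>x. R (x + 1)) has_real_derivative f x) (at x)"
      using assms(2)[of "x + 1"] assms(1) by (simp add: DERIV_shift periodic1_def)
    from DERIV_diff[OF this assms(2)] show ?thesis by simp
  qed
  then have "R (x + 1) - R x = R (0 + 1) - R 0"
    using DERIV_isconst_all[of "\<lambda>x. R (x + 1) - R x" x 0] by blast
  moreover have "(f has_integral R 1 - R 0) {0..1}"
    by (rule fundamental_theorem_of_calculus)
       (use assms(2) in \<open>auto simp: has_real_derivative_iff_has_vector_derivative[symmetric] intro: has_field_derivative_at_within\<close>)
  ultimately show ?thesis by (simp add: integral_unique)
qed

section \<open>The convergence rate\<close>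

theorem theorem4p3:
  fixes F F' F'' :: "real \<Rightarrow> real" and \<alpha> :: real and \<delta> :: "real \<Rightarrow> real"
  assumes F_per: "periodic1 F"
    and F_d1: "\<And>x. (F has_real_derivative F' x) (at x)"
    and F_d2: "\<And>x. (F' has_real_derivative F'' x) (at x)"
    and F''_cont: "continuous_on UNIV F''"
    and F_nonneg: "\<And>x. F x \<ge> 0"
    and F_zeros_fin: "finite {x\<in>{0..<1}. F x = 0}"
    and F_has_zero: "\<exists>x. F x = 0"
    and F_nondeg: "\<And>x. F x = 0 \<Longrightarrow> F'' x > 0"
    and \<alpha>_pos: "\<alpha> > 0"
    and \<delta>_pos: "\<And>\<epsilon>. \<epsilon> > 0 \<Longrightarrow> \<delta> \<epsilon> > 0"
    and \<delta>_lim: "(\<delta> \<longlongrightarrow> 0) (at_right 0)"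
    and \<delta>_ge: "\<And>\<epsilon>. \<epsilon> > 0 \<Longrightarrow> \<delta> \<epsilon> \<ge> \<alpha> * \<epsilon>"
  shows "\<exists>\<beta>>0. \<forall>c v vstar.
           c_minus F < c \<and> c < c_plus F \<and>
           (\<forall>\<epsilon>>0. viscosity_solution_T
                      (\<lambda>x r p. \<epsilon> * r + (c + p)\<^sup>2 / 2 - F x) (v \<epsilon>)) \<and>
           (\<forall>e>0. \<forall>\<^sub>F \<epsilon> in at_right 0. \<forall>x. \<bar>v \<epsilon> x - vstar x\<bar> < e)
           \<longrightarrow> (\<forall>\<^sub>F \<epsilon> in at_right 0. \<forall>x.
                  \<bar>v \<epsilon> x - vstar x\<bar> \<le> \<beta> * (\<epsilon> * \<bar>ln (\<delta> \<epsilon>)\<bar>\<^sup>2 + \<delta> \<epsilon>))"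
proof -
  have F_cont: "continuous_on UNIV F"
    using F_d1 by (meson DERIV_isCont continuous_at_imp_continuous_on)
  obtain R where R: "\<And>x. (R has_real_derivative sqrt (2 * F x)) (at x)"
    using antiderivative_on_reals[of "\<lambda>x. sqrt (2 * F x)"] F_cont
    by (metis continuous_on_mult_const continuous_on_mult_left continuous_on_real_sqrt)
  \<comment> \<open>\<open>K\<close> is both the bound on \<open>\<bar>c\<bar>\<close> and the
    period increment of \<open>R\<close>, so all constants built from it depend on \<open>F\<close>
    alone.\<close>
  define K where "K = c_plus F"
  have R_period: "R (x + 1) - R x = K" for x
    unfolding K_def c_plus_def
    by (rule antiderivative_period) (use F_per R in \<open>auto simp: periodic1_def\<close>)
  obtain x0 where x0: "F x0 = 0" using F_has_zero by blast
  define Z where "Z = {x\<in>{-1..2}. F x = 0}"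
  have Z_fin: "finite Z" unfolding Z_def by (rule finite_periodic_zeros[OF F_per F_zeros_fin])
  have "frac x0 \<in> {-1..2}" "F (frac x0) = 0"
    using x0 periodic1_frac[OF F_per, of x0] frac_ge_0[of x0] frac_lt_1[of x0]
    by (auto intro: order_trans[OF _ frac_ge_0])
  then obtain \<kappa> where \<kappa>: "\<kappa> > 0" "\<And>t. t \<in> {-1..2} \<Longrightarrow> \<exists>z\<in>Z. F t \<ge> \<kappa> * (t - z)\<^sup>2"
    using quadratic_wells[OF F_d1 F_d2 F''_cont F_nonneg F_nondeg] unfolding Z_def by blast
  obtain x1 where x1: "\<And>y. - F x1 \<le> - F y"
    using periodic1_attains_inf[of "\<lambda>x. - F x"] F_per F_cont
    by (auto simp: periodic1_def intro!: continuous_intros)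
  define b where "b = F x1 + 1"
  have b: "F x \<le> b" for x using x1[of x] by (simp add: b_def)
  have "K \<ge> 0"
    unfolding K_def c_plus_def using F_cont F_nonneg
    by (intro integral_nonneg integrable_continuous_real)
       (auto intro!: continuous_intros continuous_on_subset[OF F_cont])
  define L where "L = sqrt (2 * b + K\<^sup>2) + K"
  have "2 * b + K\<^sup>2 > 0"
    using F_nonneg[of x1] by (intro add_pos_nonneg) (auto simp: b_def)
  then have L: "L > 0"
    using \<open>K \<ge> 0\<close> by (simp add: L_def add_pos_nonneg)
  define C1 where "C1 = 2 * L / sqrt (2 * \<kappa>) + L\<^sup>2 / \<kappa>"
  define C2 where "C2 = real (card Z) * (4 * L / sqrt (2 * \<kappa>))"
  have C: "C1 > 0" "C2 \<ge> 0" using L \<kappa>(1) by (auto simp: C1_def C2_def intro!: add_pos_pos)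
  have "\<forall>\<^sub>F \<epsilon> in at_right 0. \<forall>x. \<bar>v \<epsilon> x - vstar x\<bar>
           \<le> 4 * (C1 + C2) * (\<epsilon> * \<bar>ln (\<delta> \<epsilon>)\<bar>\<^sup>2 + \<delta> \<epsilon>)"
    if c: "c_minus F < c" "c < c_plus F"
      and sol: "\<And>\<epsilon>. \<epsilon> > 0 \<Longrightarrow> viscosity_solution_T (\<lambda>x r p. \<epsilon> * r + (c + p)\<^sup>2 / 2 - F x) (v \<epsilon>)"
      and lim: "\<And>e. e > 0 \<Longrightarrow> \<forall>\<^sub>F \<epsilon> in at_right 0. \<forall>x. \<bar>v \<epsilon> x - vstar x\<bar> < e"
    for c :: real and v :: "real \<Rightarrow> real \<Rightarrow> real" and vstar :: "real \<Rightarrow> real"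
  proof -
    have cK: "\<bar>c\<bar> < K" using c by (auto simp: K_def c_plus_def c_minus_def)
    have vlim: "((\<lambda>\<eta>. v \<eta> x) \<longlongrightarrow> vstar x) (at_right 0)" for x
      by (rule tendstoI, rule eventually_mono[OF lim]) (auto simp: dist_real_def)
    \<comment> \<open>This threshold depends on \<open>c\<close>, but it only restricts how small
      \<epsilon> must be and never enters \<beta>.\<close>
    define good where "good \<epsilon> \<longleftrightarrow> 0 < \<epsilon> \<and> 2 * L / sqrt (2 * \<kappa>) * \<epsilon> < K - \<bar>c\<bar>" for \<epsilon>
    have wells: "\<exists>s S. discounted_wells F \<epsilon> c (v \<epsilon>) s S Z \<kappa> b K L K R" if "good \<epsilon>" for \<epsilon>
    proof -
      let ?s = "\<lambda>x. sqrt (2 * (F x - \<epsilon> * v \<epsilon> x))"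
      have \<epsilon>: "\<epsilon> > 0" using that by (simp add: good_def)
      have "continuous_on UNIV (v \<epsilon>)" using sol[OF \<epsilon>] by (simp add: viscosity_solution_T_def)
      then have "continuous_on UNIV ?s" by (intro continuous_intros F_cont)
      then obtain S where S: "\<And>x. (S has_real_derivative ?s x) (at x)"
        using antiderivative_on_reals by blast
      have "discounted_wells F \<epsilon> c (v \<epsilon>) ?s S Z \<kappa> b K L K R"
        by unfold_locales
           (use F_cont F_nonneg \<epsilon> sol[OF \<epsilon>] S Z_fin \<kappa> b cK L R R_period that
             in \<open>auto simp: Z_def L_def good_def\<close>)
      then show ?thesis by blast
    qed
    have cmp: "v \<eta> x \<le> v \<epsilon> x + C1 * \<epsilon> + well_error Z \<kappa> L \<eta>" if "good \<epsilon>" "good \<eta>" for \<epsilon> \<eta> x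
    proof -
      have "frac x \<in> {0..1}" using frac_ge_0[of x] frac_lt_1[of x] by auto
      then have "v \<eta> (frac x) \<le> v \<epsilon> (frac x) + C1 * \<epsilon> + well_error Z \<kappa> L \<eta>"
        unfolding C1_def using wells[OF that(1)] wells[OF that(2)] discounted_comparison by blast
      moreover have "periodic1 (v \<epsilon>)" "periodic1 (v \<eta>)"
        using sol that by (auto simp: viscosity_solution_T_def good_def)
      ultimately show ?thesis by (simp add: periodic1_frac)
    qed
    have small: "\<forall>\<^sub>F \<epsilon> in at_right 0. \<epsilon> < d" if "d > 0" for d :: real
      using that by (auto simp: eventually_at_right_field)
    have ev_pos: "\<forall>\<^sub>F \<epsilon> in at_right (0::real). \<epsilon> > 0"
      by (rule eventually_at_right_less)
    have "\<forall>\<^sub>F \<epsilon> in at_right 0. \<epsilon> < (K - \<bar>c\<bar>) / (2 * L / sqrt (2 * \<kappa>))"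
      using cK L \<kappa>(1) by (intro small) simp
    then have ev_good: "\<forall>\<^sub>F \<epsilon> in at_right 0. good \<epsilon>"
      using ev_pos
    proof eventually_elim
      case (elim \<epsilon>)
      have "2 * L / sqrt (2 * \<kappa>) > 0" using L \<kappa>(1) by simp
      with elim show ?case unfolding good_def by (simp only: pos_less_divide_eq mult.commute)
    qed
    have err: "\<forall>\<^sub>F \<eta> in at_right 0. well_error Z \<kappa> L \<eta> \<le> C2 * (\<eta> * \<bar>ln \<eta>\<bar>)"
      unfolding C2_def using \<kappa>(1) L by (rule well_error_le)
    \<comment> \<open>Fix \<epsilon> and let \<eta> tend to 0 in \<open>cmp\<close>; the error at
      \<eta> vanishes because it is at most \<open>C2 * sqrt \<eta>\<close>.\<close>
    have lower: "vstar x \<le> v \<epsilon> x + C1 * \<epsilon>" if "good \<epsilon>" for \<epsilon> x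
    proof (rule tendsto_le[OF trivial_limit_at_right_real _ vlim[of x]])
      have "((\<lambda>\<eta>. v \<epsilon> x + C1 * \<epsilon> + C2 * sqrt \<eta>) \<longlongrightarrow> v \<epsilon> x + C1 * \<epsilon> + C2 * sqrt 0) (at_right 0)"
        by (intro tendsto_intros)
      then show "((\<lambda>\<eta>. v \<epsilon> x + C1 * \<epsilon> + C2 * sqrt \<eta>) \<longlongrightarrow> v \<epsilon> x + C1 * \<epsilon>) (at_right 0)" by simp
      show "\<forall>\<^sub>F \<eta> in at_right 0. v \<eta> x \<le> v \<epsilon> x + C1 * \<epsilon> + C2 * sqrt \<eta>"
        using err ev_good ev_pos small[OF zero_less_one]
      proof eventually_elim
        case (elim \<eta>)
        then have "C2 * (\<eta> * \<bar>ln \<eta>\<bar>) \<le> C2 * sqrt \<eta>"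
          using C(2) by (intro mult_left_mono log_term_le) auto
        with elim cmp[OF \<open>good \<epsilon>\<close>, of \<eta> x] show ?case by linarith
      qed
    qed
    \<comment> \<open>Now \<open>cmp\<close> is used with the roles exchanged: the segments come
      from \<open>v \<eta>\<close>, whose linear error vanishes, and the logarithmic error stays at
      \<epsilon>.\<close>
    have upper: "v \<epsilon> x \<le> vstar x + well_error Z \<kappa> L \<epsilon>" if "good \<epsilon>" for \<epsilon> x
    proof (rule tendsto_le[OF trivial_limit_at_right_real _ tendsto_const])
      have "((\<lambda>\<eta>. v \<eta> x + C1 * \<eta> + well_error Z \<kappa> L \<epsilon>) \<longlongrightarrow>
          vstar x + C1 * 0 + well_error Z \<kappa> L \<epsilon>) (at_right 0)"
        by (intro tendsto_intros vlim)
      then show "((\<lambda>\<eta>. v \<eta> x + C1 * \<eta> + well_error Z \<kappa> L \<epsilon>) \<longlongrightarrow>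
          vstar x + well_error Z \<kappa> L \<epsilon>) (at_right 0)" by simp
      show "\<forall>\<^sub>F \<eta> in at_right 0. v \<epsilon> x \<le> v \<eta> x + C1 * \<eta> + well_error Z \<kappa> L \<epsilon>"
        using ev_good by eventually_elim (use cmp that in blast)
    qed
    have "exp (-1) > (0::real)" by simp
    from small[OF this] ev_pos ev_good err show ?thesis
    proof eventually_elim
      case (elim \<epsilon>)
      define B where "B = \<epsilon> * \<bar>ln \<epsilon>\<bar>"
      \<comment> \<open>For \<epsilon> below exp (-1) the linear error is absorbed into the
        logarithmic one.\<close>
      have "ln \<epsilon> \<le> ln (exp (-1))" using elim by (intro ln_mono) auto
      then have "\<epsilon> * 1 \<le> B" unfolding B_def using elim by (intro mult_left_mono) auto
      then have "C1 * \<epsilon> \<le> C1 * B" "C2 * B \<ge> 0" "C1 * B \<ge> 0" using C elim by auto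
      then have "\<bar>v \<epsilon> x - vstar x\<bar> \<le> (C1 + C2) * B" for x
        using lower[of \<epsilon> x] upper[of \<epsilon> x] elim by (simp add: B_def[symmetric] distrib_right)
      moreover have "B \<le> 4 * (\<epsilon> * \<bar>ln (\<delta> \<epsilon>)\<bar>\<^sup>2 + \<delta> \<epsilon>)"
        unfolding B_def using elim \<delta>_pos by (intro log_term_le_any_cutoff) auto
      then have "(C1 + C2) * B \<le> (C1 + C2) * (4 * (\<epsilon> * \<bar>ln (\<delta> \<epsilon>)\<bar>\<^sup>2 + \<delta> \<epsilon>))"
        using C by (intro mult_left_mono) auto
      ultimately have "\<bar>v \<epsilon> x - vstar x\<bar> \<le> (C1 + C2) * (4 * (\<epsilon> * \<bar>ln (\<delta> \<epsilon>)\<bar>\<^sup>2 + \<delta> \<epsilon>))" for x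
        by (rule order_trans)
      then show ?case by (simp only: mult.assoc mult.left_commute) simp
    qed
  qed
  then show ?thesis using C by (intro exI[of _ "4 * (C1 + C2)"]) auto
qed

end
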